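(* The problem of finding out the blackhole set in a directed graph $G$ is a dual problem of finding out the volcano set in the same directed graph $G$.
   Context: A directed graph $G=(V,E)$ has no self-loop and no more than one edge between any pair of nodes. An edge $e=(x,y)$ is directed from $x$ to $y$ and carries a positive weight $\omega_e$. For $B\subseteq V$ let $C=V\setminus B$. The in-weight of $B$ is $d_{in}(B)=\sum_{e=(x,y)\in E,\ x\in C,\ y\in B}\omega_e$, and the out-weight of $B$ is $d_{out}(B)=\sum_{e=(x,y)\in E,\ x\in B,\ y\in C}\omega_e$. Let $\theta$ be a pre-specified positive threshold (typically very large). A set $B\subseteq V$ is a blackhole if and only if (1) if $|B|\ge 2$, the subgraph $G(B)$ induced by $B$ is weakly connected, and (2) $d_{in}(B)/d_{out}(B)>\theta$. A set $U\subseteq V$ is a volcano if and only if (1) if $|U|\ge 2$, the subgraph $G(U)$ induced by $U$ is weakly connected, and (2) $d_{out}(U)/d_{in}(U)>\theta$. The blackhole set (respectively volcano set) of $G$ is the collection of all subsets of $V$ that are blackholes (respectively volcanoes), and the problem of finding it is to determine this collection. The word "dual" is used informally, in the following sense: the two problems are interchanged by reversing all edges. That is, the inverse graph $G'=(V,E')$ of $G$ has the same nodes, has an edge $(y,x)\in E'$ for each edge $(x,y)\in E$, and $(y,x)$ has the same weight as $(x,y)$; the problem of finding the blackhole set in $G$ is regarded as equivalent to the problem of finding the volcano set in $G'$. *)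

theory Defs
  imports "Graph_Theory.Graph_Theory" "HOL-Library.Extended_Real"
begin

text \<open>
  An edge is a pair \<open>(x, y)\<close>, so there is at most one edge from \<open>x\<close> to \<open>y\<close>; the edges \<open>(x, y)\<close> and
  \<open>(y, x)\<close> may both be present. The value of \<open>\<omega>\<close> outside \<open>parcs G\<close> is irrelevant.
\<close>

locale weighted_digraph = pair_digraph G
  for G :: "'a pair_pre_digraph" +
  fixes \<omega> :: "'a \<times> 'a \<Rightarrow> real"
  assumes weight_pos: "e \<in> parcs G \<Longrightarrow> 0 < \<omega> e"

definition d_in :: "'a pair_pre_digraph \<Rightarrow> ('a \<times> 'a \<Rightarrow> real) \<Rightarrow> 'a set \<Rightarrow> real" where
  "d_in G \<omega> B = (\<Sum>e \<in> {(x, y) \<in> parcs G. x \<in> pverts G - B \<and> y \<in> B}. \<omega> e)"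

definition d_out :: "'a pair_pre_digraph \<Rightarrow> ('a \<times> 'a \<Rightarrow> real) \<Rightarrow> 'a set \<Rightarrow> real" where
  "d_out G \<omega> B = (\<Sum>e \<in> {(x, y) \<in> parcs G. x \<in> B \<and> y \<in> pverts G - B}. \<omega> e)"

text \<open>
  The ratios are taken in \<^typ>\<open>ereal\<close>, where \<open>r / 0 = \<infinity>\<close> for \<open>r > 0\<close> and \<open>0 / 0 = 0\<close>. Thus a set with
  incoming but no outgoing weight meets the blackhole condition for every \<open>\<theta>\<close>, and a set with
  neither (such as \<open>{}\<close> or \<open>pverts G\<close>) meets it for no \<open>\<theta> > 0\<close>; likewise for volcanoes. The library
  predicate \<^const>\<open>Digraph_Component.connected\<close> on digraphs is weak connectivity.
\<close>

definition blackhole ::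
  "'a pair_pre_digraph \<Rightarrow> ('a \<times> 'a \<Rightarrow> real) \<Rightarrow> real \<Rightarrow> 'a set \<Rightarrow> bool" where
  "blackhole G \<omega> \<theta> B \<longleftrightarrow> B \<subseteq> pverts G \<and>
     (2 \<le> card B \<longrightarrow> Digraph_Component.connected (with_proj G \<restriction> B)) \<and>
     ereal (d_in G \<omega> B) / ereal (d_out G \<omega> B) > ereal \<theta>"

definition volcano ::
  "'a pair_pre_digraph \<Rightarrow> ('a \<times> 'a \<Rightarrow> real) \<Rightarrow> real \<Rightarrow> 'a set \<Rightarrow> bool" where
  "volcano G \<omega> \<theta> U \<longleftrightarrow> U \<subseteq> pverts G \<and>
     (2 \<le> card U \<longrightarrow> Digraph_Component.connected (with_proj G \<restriction> U)) \<and>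
     ereal (d_out G \<omega> U) / ereal (d_in G \<omega> U) > ereal \<theta>"

definition blackhole_set ::
  "'a pair_pre_digraph \<Rightarrow> ('a \<times> 'a \<Rightarrow> real) \<Rightarrow> real \<Rightarrow> 'a set set" where
  "blackhole_set G \<omega> \<theta> = {B. blackhole G \<omega> \<theta> B}"

definition volcano_set ::
  "'a pair_pre_digraph \<Rightarrow> ('a \<times> 'a \<Rightarrow> real) \<Rightarrow> real \<Rightarrow> 'a set set" where
  "volcano_set G \<omega> \<theta> = {U. volcano G \<omega> \<theta> U}"

definition inverse_graph :: "'a pair_pre_digraph \<Rightarrow> 'a pair_pre_digraph" where
  "inverse_graph G = \<lparr> pverts = pverts G, parcs = {(y, x) | x y. (x, y) \<in> parcs G} \<rparr>"

definition inverse_weight :: "('a \<times> 'a \<Rightarrow> real) \<Rightarrow> 'a \<times> 'a \<Rightarrow> real" where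
  "inverse_weight \<omega> = (\<lambda>(y, x). \<omega> (x, y))"

lemma weighted_digraph_inverse:
  assumes "weighted_digraph G \<omega>"
  shows "weighted_digraph (inverse_graph G) (inverse_weight \<omega>)"
proof -
  interpret weighted_digraph G \<omega> by fact
  have "parcs (inverse_graph G) = prod.swap ` parcs G"
    by (force simp: inverse_graph_def)
  then have "finite (parcs (inverse_graph G))"
    by simp
  then show ?thesis
    by unfold_locales
      (auto simp: inverse_graph_def inverse_weight_def weight_pos
        dest: in_arcsD1 in_arcsD2 no_loops')
qed

lemma inverse_inverse:
  "inverse_graph (inverse_graph G) = G" "inverse_weight (inverse_weight \<omega>) = \<omega>"
proof -
  have "{(y, x) | x y. (y, x) \<in> parcs G} = parcs G"
    by auto
  then show "inverse_graph (inverse_graph G) = G"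
    by (simp add: inverse_graph_def)
qed (simp add: inverse_weight_def)

end

theory Submission
  imports Defs
begin

text \<open>Reversing every edge while keeping its weight turns the edges entering \<open>B\<close>
  into those leaving it. So \<open>d_in\<close> and \<open>d_out\<close> trade places
  (\<open>d_in_inverse\<close>, \<open>d_out_inverse\<close>), and the two ratios with them, while
  weak connectivity ignores direction (\<open>connected_induce_inverse\<close>). This matches
  blackholes of \<open>G\<close> with volcanoes of its inverse; the other equality follows because
  reversal is an involution.\<close>

lemma d_in_inverse: "d_in (inverse_graph G) (inverse_weight \<omega>) B = d_out G \<omega> B"
  unfolding d_in_def d_out_def
  \<comment> \<open>Swapping endpoints is its own inverse and preserves weights.\<close>
  by (rule sum.reindex_bij_witness[of _ prod.swap prod.swap])
    (auto simp: inverse_graph_def inverse_weight_def)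

lemma d_out_inverse: "d_out (inverse_graph G) (inverse_weight \<omega>) B = d_in G \<omega> B"
  using d_in_inverse[of "inverse_graph G" "inverse_weight \<omega>" B] by (simp add: inverse_inverse)

lemma pverts_inverse: "pverts (inverse_graph G) = pverts G"
  by (simp add: inverse_graph_def)

text \<open>Weak connectivity is strong connectivity of the symmetric closure. That closure contains
  each edge in both directions, so it cannot tell a graph from its reversal.\<close>

lemma mk_symmetric_induce_inverse:
  "mk_symmetric (with_proj (inverse_graph G) \<restriction> B) = mk_symmetric (with_proj G \<restriction> B)"
  by (auto simp: mk_symmetric_def induce_subgraph_def inverse_graph_def arcs_ends_conv) blast+

lemma connected_induce_inverse:
  "Digraph_Component.connected (with_proj (inverse_graph G) \<restriction> B) \<longleftrightarrow>
    Digraph_Component.connected (with_proj G \<restriction> B)"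
  by (simp only: connected_def mk_symmetric_induce_inverse)

lemma volcano_inverse:
  "volcano (inverse_graph G) (inverse_weight \<omega>) \<theta> B \<longleftrightarrow> blackhole G \<omega> \<theta> B"
  by (simp add: volcano_def blackhole_def d_in_inverse d_out_inverse pverts_inverse
      connected_induce_inverse)

lemma blackhole_inverse:
  "blackhole (inverse_graph G) (inverse_weight \<omega>) \<theta> B \<longleftrightarrow> volcano G \<omega> \<theta> B"
  \<comment> \<open>Read backwards, \<open>volcano_inverse\<close> reverses the graph a second time,
    which restores \<open>G\<close> and \<omega>.\<close>
  by (simp add: inverse_inverse flip: volcano_inverse)

theorem theorem1:
  fixes G :: "'a pair_pre_digraph" and \<omega> :: "'a \<times> 'a \<Rightarrow> real" and \<theta> :: real
  assumes "weighted_digraph G \<omega>" and "\<theta> > 0"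
  shows "blackhole_set G \<omega> \<theta> = volcano_set (inverse_graph G) (inverse_weight \<omega>) \<theta> \<and>
    volcano_set G \<omega> \<theta> = blackhole_set (inverse_graph G) (inverse_weight \<omega>) \<theta>"
  by (simp add: blackhole_set_def volcano_set_def volcano_inverse blackhole_inverse)

end
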